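(* Assume $\sigma^2, \tilde b \in C^1([0,1])$ with $\min_{[0,1]} \sigma^2 > 0$, and let $\tilde f \in C^1([0,1])$ satisfy $\tilde f(0) = \tilde f(1) = 0$, with exactly one interior zero $q^* \in (0,1)$, $\tilde f < 0$ on $(0, q^* )$, $\tilde f > 0$ on $(q^*, 1)$, and $\tilde f'(0) < 0$, $\tilde f'(q^* ) > 0$, $\tilde f'(1) < 0$. Let $(c,V)$ be the traveling wave described in the context. Then $1 - V(y) = e^{-\alpha y (1 + o(1))}$ as $y \to \infty$, where $$\alpha \;=\; \frac{a + \sqrt{a^{2} - 2\,\sigma^{2}(1)\,\tilde f'(1)}}{\sigma^{2}(1)}, \qquad a = c - \tilde b(1),$$ that is, the capitalization distribution $x\mapsto V(\log x)$ of the wave has a Pareto tail with exponent $\alpha$ at the top of the market. Symmetrically, $V(y) = e^{\beta y (1 + o(1))}$ as $y \to -\infty$, where $\beta$ is the positive root $r$ of $$\tfrac{1}{2}\,\sigma^2(0)\, r^2 + \big(c - \tilde b(0)\big)\, r + \tilde f'(0) = 0.$$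
   Context: Here $\sigma^2:[0,1]\to(0,\infty)$. Under the stated hypotheses there is a unique speed $c\in\mathbb{R}$, and a profile $V$ unique up to translation, such that $V\in C^2(\mathbb{R})$ is strictly increasing, $V(-\infty)=0$, $V(+\infty)=1$, and $$\frac{d}{d\xi}\Big(\frac{\sigma^2(V)}{2}\,V'\Big) + \big(c - \tilde b(V)\big)\,V' + \tilde f(V) = 0 .$$ This $(c,V)$ is the traveling wave; the variable $y=\log x$ is log capitalization. *)

theory Defs
  imports "HOL-Analysis.Analysis" "HOL-Library.Landau_Symbols"
begin

(* Derivative of a function given on [0,1]: one-sided at the endpoints, so that values of the
   HOL function outside [0,1] are irrelevant. *)
abbreviation deriv01 :: "(real \<Rightarrow> real) \<Rightarrow> real \<Rightarrow> real"
  where "deriv01 g u \<equiv> vector_derivative g (at u within {0..1})"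

definition C1_01 :: "(real \<Rightarrow> real) \<Rightarrow> bool"
  where "C1_01 g \<longleftrightarrow> g differentiable_on {0..1} \<and> continuous_on {0..1} (deriv01 g)"

definition C2_real :: "(real \<Rightarrow> real) \<Rightarrow> bool"
  where "C2_real V \<longleftrightarrow> V differentiable_on UNIV \<and> deriv V differentiable_on UNIV \<and>
           continuous_on UNIV (deriv (deriv V))"

(* The argument s stands for the squared volatility sigma^2 as a function of the rank u in [0,1].
   Strict monotonicity and the two limits force V to take values in (0,1), so for s of class C^1
   on [0,1] the flux is differentiable and the outer deriv is a genuine derivative. *)
definition travelling_wave ::
    "(real \<Rightarrow> real) \<Rightarrow> (real \<Rightarrow> real) \<Rightarrow> (real \<Rightarrow> real) \<Rightarrow> real \<Rightarrow> (real \<Rightarrow> real) \<Rightarrow> bool"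
  where "travelling_wave s b f c V \<longleftrightarrow>
           C2_real V \<and> strict_mono V \<and> (V \<longlongrightarrow> 0) at_bot \<and> (V \<longlongrightarrow> 1) at_top \<and>
           (\<forall>\<xi>. deriv (\<lambda>\<eta>. s (V \<eta>) / 2 * deriv V \<eta>) \<xi> + (c - b (V \<xi>)) * deriv V \<xi> + f (V \<xi>) = 0)"

(* Pareto tail on the logarithmic scale: 1 - F(x) = x^(-alpha (1 + o(1))) as x tends to infinity. *)
definition pareto_tail :: "(real \<Rightarrow> real) \<Rightarrow> real \<Rightarrow> bool"
  where "pareto_tail F \<alpha> \<longleftrightarrow> \<alpha> > 0 \<and>
           (\<exists>\<epsilon> \<in> o[at_top](\<lambda>_. 1). \<forall>\<^sub>F x in at_top. 1 - F x = x powr (- \<alpha> * (1 + \<epsilon> x)))"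

end

theory Submission
  imports Defs "HOL-Library.Quadratic_Discriminant"
begin

text \<open>
  Near either end the wave gives a positive decreasing solution \<open>W \<rightarrow> 0\<close> of an asymptotically
  autonomous linear equation \<open>(p W')' + k W' + g W = 0\<close> on the half line, with \<open>W = 1 - V\<close> at
  \<open>+\<infinity>\<close> and \<open>W(y) = V(-y)\<close> at \<open>-\<infinity>\<close>. The flux ratio \<open>z = - p W' / W\<close> is nonnegative and solves
  the Riccati equation \<open>z' = (z\<^sup>2 - k z + p g) / p\<close>, whose limiting right-hand side has one positive
  and one negative root because \<open>g\<close> tends to a negative number. The positive root is repelling: from
  above it \<open>z\<close> would blow up in finite time, from below it would become negative. Hence \<open>z\<close> tends
  to it, and integrating \<open>W' / W = - z / p\<close> gives the decay rate of \<open>W\<close>.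
\<close>

section \<open>Barrier argument and the scalar Riccati equation\<close>

text \<open>The level \<open>M\<close> is a barrier from below: up to a first return to it the
  derivative is at least \<open>\<delta>\<close>, so \<open>h\<close> cannot have come down. Hence
  \<open>h\<close> stays above \<open>M\<close>, grows at least linearly and passes any bound
  \<open>B\<close>.\<close>

lemma no_bounded_escape:
  fixes h h' :: "real \<Rightarrow> real"
  assumes der: "\<And>y. y \<ge> y0 \<Longrightarrow> (h has_real_derivative h' y) (at y)"
    and start: "h y0 > M" and "\<delta> > 0"
    and incr: "\<And>y. y \<ge> y0 \<Longrightarrow> h y \<ge> M \<Longrightarrow> h' y \<ge> \<delta>"
    and bound: "\<And>y. y \<ge> y0 \<Longrightarrow> h y \<le> B"
  shows False
proof -
  have above: "h y \<ge> M" if "y \<ge> y0" for y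
  proof (rule ccontr)
    assume "\<not> h y \<ge> M"
    \<comment> \<open>Compactness of \<open>S\<close> yields the first time \<open>t\<close> at
      which \<open>h\<close> is at most \<open>M\<close>.\<close>
    define S where "S = {t \<in> {y0..y}. h t \<le> M}"
    have cont: "continuous_on {y0..y} h"
      by (intro continuous_at_imp_continuous_on ballI) (auto intro: DERIV_isCont[OF der])
    have "closed S"
      unfolding S_def by (intro continuous_on_closed_Collect_le cont) auto
    moreover have "bounded S"
      by (rule bounded_subset[of "{y0..y}"]) (auto simp: S_def)
    ultimately have "compact S" by (simp add: compact_eq_bounded_closed)
    moreover have "S \<noteq> {}" using \<open>\<not> h y \<ge> M\<close> that by (auto simp: S_def)
    ultimately obtain t where t: "t \<in> S" "\<And>s. s \<in> S \<Longrightarrow> t \<le> s"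
      using compact_attains_inf[of S] by blast
    have before: "h s \<ge> M" if "y0 \<le> s" "s < t" for s
      using t(2)[of s] t(1) that by (force simp: S_def)
    have "t \<noteq> y0" using t(1) start by (auto simp: S_def)
    then have "y0 < t" using t(1) by (auto simp: S_def)
    then have "\<exists>s. y0 < s \<and> s < t \<and> h t - h y0 = (t - y0) * h' s"
      by (intro MVT2) (auto intro: der)
    then obtain s where s: "y0 < s" "s < t" "h t - h y0 = (t - y0) * h' s" by blast
    have "h' s > 0" using incr[of s] before[of s] s \<open>\<delta> > 0\<close> by auto
    then have "h t > h y0" using s \<open>y0 < t\<close> by (smt (verit) mult_pos_pos)
    then show False using t(1) start by (auto simp: S_def)
  qed
  have growth: "h y0 + \<delta> * (y - y0) \<le> h y" if "y > y0" for y
  proof -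
    have "\<exists>s. y0 < s \<and> s < y \<and> h y - h y0 = (y - y0) * h' s"
      using that by (intro MVT2) (auto intro: der)
    then obtain s where s: "y0 < s" "h y - h y0 = (y - y0) * h' s" by blast
    have "(y - y0) * h' s \<ge> (y - y0) * \<delta>"
      using incr[of s] above[of s] s that by (intro mult_left_mono) auto
    then show ?thesis using s by (simp add: mult.commute)
  qed
  \<comment> \<open>At this point the linear lower bound equals
    \<open>h y0 + \<bar>B - h y0\<bar> + 1\<close>, which exceeds \<open>B\<close>.\<close>
  define y where "y = y0 + (\<bar>B - h y0\<bar> + 1) / \<delta>"
  have "y > y0" using \<open>\<delta> > 0\<close> by (simp add: y_def)
  moreover have "\<delta> * (y - y0) = \<bar>B - h y0\<bar> + 1" using \<open>\<delta> > 0\<close> by (simp add: y_def)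
  ultimately show False using growth[of y] bound[of y] by linarith
qed

text \<open>No initial value is prescribed: existence of \<open>z\<close> on the whole line and
  \<open>z y \<ge> 0\<close> already single out the limit. Both ways of leaving a neighbourhood of
  \<open>r\<close> contradict \<open>no_bounded_escape\<close>, applied to
  \<open>- 1 / (1 + z)\<close> above \<open>r\<close> and to \<open>- z\<close> below it.\<close>

lemma riccati_limit:
  fixes z p k g :: "real \<Rightarrow> real"
  assumes der: "\<And>y. (z has_real_derivative ((z y)\<^sup>2 - k y * z y + p y * g y) / p y) (at y)"
    and nonneg: "\<And>y. z y \<ge> 0"
    and lims: "(p \<longlongrightarrow> p0) at_top" "(k \<longlongrightarrow> k0) at_top" "(g \<longlongrightarrow> g0) at_top"
    and "p0 > 0" "g0 < 0"
    and "r > 0" and root: "r\<^sup>2 - k0 * r + p0 * g0 = 0"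
  shows "(z \<longlongrightarrow> r) at_top"
proof -
  \<comment> \<open>By Vieta, \<open>- s\<close> is the other root of the limiting quadratic;
    \<open>s > 0\<close> because \<open>p0 * g0 < 0\<close>.\<close>
  define s where "s = - p0 * g0 / r"
  have "s > 0" using assms by (simp add: s_def mult_neg_pos divide_neg_pos mult_pos_neg)
  have rs: "p0 * g0 = - r * s" using \<open>r > 0\<close> by (simp add: s_def)
  have "r * (r - k0 - s) = 0" using root rs by (simp add: power2_eq_square algebra_simps)
  then have k0: "k0 = r - s" using \<open>r > 0\<close> by simp
  have factor: "x\<^sup>2 - k y * x + p y * g y
      = (x - r) * (x + s) + ((p y * g y - p0 * g0) - (k y - k0) * x)" for x y
    unfolding rs k0 by (simp add: algebra_simps power2_eq_square)
  have near: "\<forall>\<^sub>F y in at_top. \<bar>k y - k0\<bar> \<le> \<eta> \<and> \<bar>p y * g y - p0 * g0\<bar> \<le> \<eta>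
      \<and> p y > 0 \<and> p y \<le> 2 * p0" if "\<eta> > 0" for \<eta>
  proof -
    have "\<forall>\<^sub>F y in at_top. dist (k y) k0 < \<eta>"
      using tendstoD[OF lims(2) that] .
    moreover have "\<forall>\<^sub>F y in at_top. dist (p y * g y) (p0 * g0) < \<eta>"
      using tendstoD[OF tendsto_mult[OF lims(1) lims(3)] that] .
    moreover have "\<forall>\<^sub>F y in at_top. dist (p y) p0 < p0"
      using tendstoD[OF lims(1) \<open>p0 > 0\<close>] .
    ultimately show ?thesis
      by eventually_elim (auto simp: dist_real_def abs_if split: if_splits)
  qed
  \<comment> \<open>The error is at most linear in \<open>x\<close>, so the quadratic main term can
    absorb it even for large \<open>x\<close>.\<close>
  have perturbation: "\<bar>(p y * g y - p0 * g0) - (k y - k0) * x\<bar> \<le> \<eta> * (1 + x)"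
    if "\<bar>k y - k0\<bar> \<le> \<eta>" "\<bar>p y * g y - p0 * g0\<bar> \<le> \<eta>" "x \<ge> 0" for x y \<eta>
  proof -
    have "\<bar>(p y * g y - p0 * g0) - (k y - k0) * x\<bar>
        \<le> \<bar>p y * g y - p0 * g0\<bar> + \<bar>(k y - k0) * x\<bar>"
      by (rule abs_triangle_ineq4)
    also have "\<dots> = \<bar>p y * g y - p0 * g0\<bar> + \<bar>k y - k0\<bar> * x"
      using that by (simp add: abs_mult)
    also have "\<dots> \<le> \<eta> + \<eta> * x" using that by (intro add_mono mult_right_mono) auto
    finally show ?thesis by (simp add: algebra_simps)
  qed
  have upper: "\<forall>\<^sub>F y in at_top. z y \<le> r + \<epsilon>" if "\<epsilon> > 0" for \<epsilon>
  proof -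
    \<comment> \<open>These constants give \<open>c1 * (1 + x) \<le> x - r\<close> for
      \<open>x \<ge> r + \<epsilon>\<close>, with equality at \<open>r + \<epsilon>\<close>, and
      \<open>c2 * (1 + x) \<le> x + s\<close>. The product of the two bounds is
      \<open>2 * \<eta> * (1 + x)\<^sup>2\<close>; half of it pays for the perturbation.\<close>
    define c1 where "c1 = \<epsilon> / (1 + r + \<epsilon>)"
    define c2 where "c2 = min 1 s"
    define \<eta> where "\<eta> = c1 * c2 / 2"
    have pos: "c1 > 0" "c2 > 0" "c2 \<le> 1" "c2 \<le> s"
      using that \<open>r > 0\<close> \<open>s > 0\<close> by (auto simp: c1_def c2_def)
    then have "\<eta> > 0" by (simp add: \<eta>_def)
    \<comment> \<open>The right-hand side is the derivative of \<open>- 1 / (1 + z)\<close> along a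
      solution, with \<open>x\<close> in place of \<open>z y\<close>.\<close>
    have rate: "\<eta> / (2 * p0) \<le> (x\<^sup>2 - k y * x + p y * g y) / p y / (1 + x)\<^sup>2"
      if near: "\<bar>k y - k0\<bar> \<le> \<eta>" "\<bar>p y * g y - p0 * g0\<bar> \<le> \<eta>" "p y > 0" "p y \<le> 2 * p0"
        and x: "x \<ge> r + \<epsilon>" for x y
    proof -
      have "x > 0" using x \<open>\<epsilon> > 0\<close> \<open>r > 0\<close> by simp
      have "\<epsilon> * (1 + x) \<le> (x - r) * (1 + r + \<epsilon>)"
      proof -
        have "(x - r) * (1 + r + \<epsilon>) - \<epsilon> * (1 + x) = (1 + r) * (x - (r + \<epsilon>))"
          by (simp add: algebra_simps)
        also have "\<dots> \<ge> 0" using x \<open>r > 0\<close> by simp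
        finally show ?thesis by simp
      qed
      then have "c1 * (1 + x) \<le> x - r"
        using \<open>r > 0\<close> \<open>\<epsilon> > 0\<close> by (simp add: c1_def divide_simps)
      moreover have "c2 * (1 + x) \<le> x + s"
      proof -
        have "c2 * x \<le> 1 * x" using pos \<open>x > 0\<close> by (intro mult_right_mono) auto
        then show ?thesis using pos by (simp add: algebra_simps)
      qed
      ultimately have "(c1 * (1 + x)) * (c2 * (1 + x)) \<le> (x - r) * (x + s)"
        using pos \<open>x > 0\<close> x \<open>\<epsilon> > 0\<close> by (intro mult_mono) auto
      then have "2 * \<eta> * (1 + x)\<^sup>2 \<le> (x - r) * (x + s)"
        by (simp add: \<eta>_def power2_eq_square algebra_simps)
      moreover have "\<eta> * (1 + x) \<le> \<eta> * (1 + x)\<^sup>2"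
        using \<open>\<eta> > 0\<close> \<open>x > 0\<close> by (intro mult_left_mono) (auto simp: power2_eq_square)
      ultimately have main: "\<eta> * (1 + x)\<^sup>2 \<le> x\<^sup>2 - k y * x + p y * g y"
        using perturbation[OF near(1,2), of x] \<open>x > 0\<close> unfolding factor by linarith
      have "\<eta> / (2 * p0) \<le> \<eta> / p y"
        using near \<open>\<eta> > 0\<close> by (intro divide_left_mono) auto
      also have "\<dots> = \<eta> * (1 + x)\<^sup>2 / p y / (1 + x)\<^sup>2" using \<open>x > 0\<close> by simp
      also have "\<dots> \<le> (x\<^sup>2 - k y * x + p y * g y) / p y / (1 + x)\<^sup>2"
        using main near by (intro divide_right_mono) auto
      finally show ?thesis .
    qed
    obtain N where N: "\<And>y. y \<ge> N \<Longrightarrow> \<bar>k y - k0\<bar> \<le> \<eta> \<and> \<bar>p y * g y - p0 * g0\<bar> \<le> \<eta>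
      \<and> p y > 0 \<and> p y \<le> 2 * p0"
      using near[OF \<open>\<eta> > 0\<close>] unfolding eventually_at_top_linorder by blast
    have "z y0 \<le> r + \<epsilon>" if "y0 \<ge> N" for y0
    proof (rule ccontr)
      assume big: "\<not> z y0 \<le> r + \<epsilon>"
      \<comment> \<open>Finite-time blow-up: \<open>- 1 / (1 + z)\<close> stays below 0 but would grow at a definite rate.\<close>
      define h where "h y = - 1 / (1 + z y)" for y
      show False
      proof (rule no_bounded_escape[of y0 h])
        show "(h has_real_derivative
            ((z y)\<^sup>2 - k y * z y + p y * g y) / p y / (1 + z y)\<^sup>2) (at y)" for y
          unfolding h_def using nonneg[of y]
          by (auto intro!: derivative_eq_intros der simp: power2_eq_square divide_simps)
        show "- 1 / (1 + (r + \<epsilon>)) < h y0"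
          unfolding h_def using big \<open>r > 0\<close> \<open>\<epsilon> > 0\<close> by (simp add: divide_simps)
        show "\<eta> / (2 * p0) > 0" using \<open>\<eta> > 0\<close> \<open>p0 > 0\<close> by simp
        show "\<eta> / (2 * p0) \<le> ((z y)\<^sup>2 - k y * z y + p y * g y) / p y / (1 + z y)\<^sup>2"
          if "y \<ge> y0" "- 1 / (1 + (r + \<epsilon>)) \<le> h y" for y
        proof -
          have "z y \<ge> r + \<epsilon>"
            using that(2) \<open>r > 0\<close> \<open>\<epsilon> > 0\<close> nonneg[of y] unfolding h_def
            by (simp add: divide_simps)
          then show ?thesis using rate[of y "z y"] N[of y] that \<open>y0 \<ge> N\<close> by auto
        qed
        show "h y \<le> 0" for y unfolding h_def using nonneg[of y] by simp
      qed
    qed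
    then show ?thesis unfolding eventually_at_top_linorder by blast
  qed
  have lower: "\<forall>\<^sub>F y in at_top. z y \<ge> r - \<epsilon>" if "\<epsilon> > 0" for \<epsilon>
  proof -
    \<comment> \<open>For \<open>0 \<le> x \<le> r - \<epsilon>\<close> the product
      \<open>(r - x) * (x + s)\<close> is at least \<open>\<epsilon> * s\<close>; this
      \<open>\<eta>\<close> keeps the perturbation below half of that.\<close>
    define \<eta> where "\<eta> = \<epsilon> * s / (2 * (1 + r))"
    have "\<eta> > 0" using that \<open>s > 0\<close> \<open>r > 0\<close> by (simp add: \<eta>_def)
    have \<eta>r: "\<eta> * (1 + r) = \<epsilon> * s / 2"
      using \<open>r > 0\<close> by (simp add: \<eta>_def field_simps)
    have rate: "(x\<^sup>2 - k y * x + p y * g y) / p y \<le> - (\<epsilon> * s / 2 / (2 * p0))"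
      if near: "\<bar>k y - k0\<bar> \<le> \<eta>" "\<bar>p y * g y - p0 * g0\<bar> \<le> \<eta>" "p y > 0" "p y \<le> 2 * p0"
        and x: "x \<le> r - \<epsilon>" "x \<ge> 0" for x y
    proof -
      have "\<epsilon> * s \<le> (r - x) * (x + s)"
        using x \<open>\<epsilon> > 0\<close> \<open>s > 0\<close> by (intro mult_mono) auto
      moreover have "\<eta> * (1 + x) \<le> \<eta> * (1 + r)"
        using \<open>\<eta> > 0\<close> x \<open>\<epsilon> > 0\<close> by (intro mult_left_mono) auto
      moreover have "(x - r) * (x + s) = - ((r - x) * (x + s))" by (simp add: algebra_simps)
      ultimately have main: "x\<^sup>2 - k y * x + p y * g y \<le> - (\<epsilon> * s / 2)"
        using perturbation[OF near(1,2), of x] x \<eta>r unfolding factor by linarith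
      have "(x\<^sup>2 - k y * x + p y * g y) / p y \<le> - (\<epsilon> * s / 2) / p y"
        using main near by (intro divide_right_mono) auto
      also have "\<epsilon> * s / 2 / (2 * p0) \<le> \<epsilon> * s / 2 / p y"
        using near \<open>\<epsilon> > 0\<close> \<open>s > 0\<close> by (intro divide_left_mono) auto
      then have "- (\<epsilon> * s / 2) / p y \<le> - (\<epsilon> * s / 2 / (2 * p0))" by simp
      finally show ?thesis .
    qed
    obtain N where N: "\<And>y. y \<ge> N \<Longrightarrow> \<bar>k y - k0\<bar> \<le> \<eta> \<and> \<bar>p y * g y - p0 * g0\<bar> \<le> \<eta>
      \<and> p y > 0 \<and> p y \<le> 2 * p0"
      using near[OF \<open>\<eta> > 0\<close>] unfolding eventually_at_top_linorder by blast
    have "z y0 \<ge> r - \<epsilon>" if "y0 \<ge> N" for y0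
    proof (rule ccontr)
      assume small: "\<not> z y0 \<ge> r - \<epsilon>"
      show False
      proof (rule no_bounded_escape[of y0 "\<lambda>y. - z y"])
        show "((\<lambda>y. - z y) has_real_derivative
            - (((z y)\<^sup>2 - k y * z y + p y * g y) / p y)) (at y)" for y
          by (intro DERIV_minus der)
        show "- (r - \<epsilon>) < - z y0" using small by simp
        show "\<epsilon> * s / 2 / (2 * p0) > 0" using \<open>\<epsilon> > 0\<close> \<open>s > 0\<close> \<open>p0 > 0\<close> by simp
        show "\<epsilon> * s / 2 / (2 * p0) \<le> - (((z y)\<^sup>2 - k y * z y + p y * g y) / p y)"
          if "y \<ge> y0" "- (r - \<epsilon>) \<le> - z y" for y
          using rate[of y "z y"] N[of y] that \<open>y0 \<ge> N\<close> nonneg[of y] by auto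
        show "- z y \<le> 0" for y using nonneg[of y] by simp
      qed
    qed
    then show ?thesis unfolding eventually_at_top_linorder by blast
  qed
  show ?thesis
  proof (rule tendstoI)
    fix e :: real assume "e > 0"
    then have "e / 2 > 0" by simp
    from upper[OF this] lower[OF this] show "\<forall>\<^sub>F y in at_top. dist (z y) r < e"
      by eventually_elim (use \<open>e > 0\<close> in \<open>auto simp: dist_real_def abs_if\<close>)
  qed
qed

section \<open>Logarithmic decay of positive solutions of the linear equation\<close>

text \<open>The ratio is formed with the flux \<open>p W'\<close> and not with \<open>W'\<close>
  alone, because \<open>ode\<close> differentiates only the flux. The Riccati equation for
  \<open>z\<close> then contains no derivative of \<open>p\<close>.\<close>

lemma log_decay_rate:
  fixes W W' p k g :: "real \<Rightarrow> real"
  assumes der: "\<And>y. (W has_real_derivative W' y) (at y)"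
    and ode: "\<And>y. ((\<lambda>y. p y * W' y) has_real_derivative - (k y * W' y + g y * W y)) (at y)"
    and pos: "\<And>y. W y > 0" "\<And>y. p y > 0" and decr: "\<And>y. W' y \<le> 0"
    and lims: "(p \<longlongrightarrow> p0) at_top" "(k \<longlongrightarrow> k0) at_top" "(g \<longlongrightarrow> g0) at_top"
    and "p0 > 0" "g0 < 0"
    and "r > 0" and root: "p0 * r\<^sup>2 - k0 * r + g0 = 0"
  shows "((\<lambda>y. ln (W y) / y) \<longlongrightarrow> - r) at_top"
proof -
  define z where "z y = - (p y * W' y) / W y" for y
  have "(z \<longlongrightarrow> p0 * r) at_top"
  proof (rule riccati_limit[OF _ _ lims \<open>p0 > 0\<close> \<open>g0 < 0\<close>])
    show "(z has_real_derivative ((z y)\<^sup>2 - k y * z y + p y * g y) / p y) (at y)" for y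
    proof -
      have "(z has_real_derivative
          (- (- (k y * W' y + g y * W y)) * W y - - (p y * W' y) * W' y) / (W y * W y)) (at y)"
        unfolding z_def using pos(1)[of y]
        by (intro DERIV_divide DERIV_minus ode der) auto
      moreover have "(- (- (k y * W' y + g y * W y)) * W y - - (p y * W' y) * W' y) / (W y * W y)
          = ((z y)\<^sup>2 - k y * z y + p y * g y) / p y"
        unfolding z_def using pos(1)[of y] pos(2)[of y]
        by (simp add: field_simps power2_eq_square)
      ultimately show ?thesis by simp
    qed
    show "z y \<ge> 0" for y
      unfolding z_def using pos[of y] decr[of y] by (simp add: mult_nonneg_nonpos divide_nonpos_pos)
    show "p0 * r > 0" using \<open>p0 > 0\<close> \<open>r > 0\<close> by simp
    \<comment> \<open>Since \<open>z\<close> is a flux ratio, its limit is \<open>p0 * r\<close>;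
      scaling the characteristic equation by \<open>p0\<close> gives the equation for it.\<close>
    have "(p0 * r)\<^sup>2 - k0 * (p0 * r) + p0 * g0 = p0 * (p0 * r\<^sup>2 - k0 * r + g0)"
      by (simp add: algebra_simps power2_eq_square)
    then show "(p0 * r)\<^sup>2 - k0 * (p0 * r) + p0 * g0 = 0" using root by simp
  qed
  then have "((\<lambda>y. - (z y / p y)) \<longlongrightarrow> - (p0 * r / p0)) at_top"
    using \<open>p0 > 0\<close> by (intro tendsto_intros lims) auto
  \<comment> \<open>The trailing \<open>/ 1\<close> is the derivative of the denominator
    \<open>y\<close> in l'Hospital's rule. That rule asks only the denominator to diverge.\<close>
  moreover have "(\<lambda>y. - (z y / p y)) = (\<lambda>y. W' y / W y / 1)"
    unfolding z_def using pos by (auto simp: fun_eq_iff less_imp_neq[symmetric])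
  ultimately have quot: "((\<lambda>y. W' y / W y / 1) \<longlongrightarrow> - r) at_top"
    using \<open>p0 > 0\<close> by simp
  show ?thesis
  proof (rule lhospital_at_top_at_top[OF _ _ _ _ quot])
    show "\<forall>\<^sub>F y in at_top. ((\<lambda>y. ln (W y)) has_real_derivative W' y / W y) (at y)"
      using pos by (auto intro!: always_eventually derivative_eq_intros der simp: divide_simps)
  qed (auto intro!: filterlim_ident)
qed

section \<open>Exponential form of the asymptotics and the characteristic root\<close>

text \<open>Solving the equation for \<open>\<epsilon>\<close> gives
  \<open>ln (U y) / (r * y) - 1\<close>, which tends to 0. The filter is left general to serve both
  ends of the line.\<close>

lemma exp_asymptotics:
  fixes U :: "real \<Rightarrow> real"
  assumes lim: "((\<lambda>y. ln (U y) / y) \<longlongrightarrow> r) F" and "r \<noteq> 0"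
    and pos: "\<And>y. U y > 0" and nz: "\<forall>\<^sub>F y in F. y \<noteq> 0"
  shows "\<exists>\<epsilon> \<in> o[F](\<lambda>_. 1). \<forall>\<^sub>F y in F. U y = exp (r * y * (1 + \<epsilon> y))"
proof
  define \<epsilon> where "\<epsilon> y = ln (U y) / y / r - 1" for y
  have "(\<epsilon> \<longlongrightarrow> r / r - 1) F"
    unfolding \<epsilon>_def using \<open>r \<noteq> 0\<close> by (intro tendsto_intros lim)
  then show "\<epsilon> \<in> o[F](\<lambda>_. 1)"
    using \<open>r \<noteq> 0\<close> by (intro smalloI_tendsto) auto
  show "\<forall>\<^sub>F y in F. U y = exp (r * y * (1 + \<epsilon> y))"
    using nz by eventually_elim (use pos \<open>r \<noteq> 0\<close> in \<open>simp add: \<epsilon>_def\<close>)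
qed

text \<open>As \<open>A * C < 0\<close>, the root of the discriminant exceeds
  \<open>\<bar>B\<bar>\<close>, so the two real roots have opposite signs.\<close>

lemma quadratic_positive_root:
  fixes A B C :: real
  assumes "A > 0" "C < 0"
  shows "{r. r > 0 \<and> A * r\<^sup>2 + B * r + C = 0} = {(- B + sqrt (B\<^sup>2 - 4 * A * C)) / (2 * A)}"
proof -
  define D where "D = B\<^sup>2 - 4 * A * C"
  have "A * C < 0" using assms by (simp add: mult_pos_neg)
  then have "D > B\<^sup>2" by (simp add: D_def)
  then have D: "sqrt D > \<bar>B\<bar>" using real_sqrt_less_mono[of "B\<^sup>2" D] by simp
  have "D \<ge> 0" using \<open>D > B\<^sup>2\<close> zero_le_power2[of B] by linarith
  have eq: "A * r\<^sup>2 + B * r + C = 0 \<longleftrightarrow>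
      r = (- B + sqrt D) / (2 * A) \<or> r = (- B - sqrt D) / (2 * A)" for r
    using discriminant_nonneg[of A B C r] assms \<open>D \<ge> 0\<close> by (auto simp: D_def discrim_def)
  have "(- B - sqrt D) / (2 * A) < 0" "(- B + sqrt D) / (2 * A) > 0"
    using D assms by (auto simp: divide_neg_pos)
  then show ?thesis unfolding D_def[symmetric] eq by auto
qed

section \<open>Functions of class C^1 on the closed unit interval\<close>

lemma C1_01_has_derivative:
  assumes "C1_01 g" "u \<in> {0..1}"
  shows "(g has_real_derivative deriv01 g u) (at u within {0..1})"
  using assms
  by (simp add: C1_01_def differentiable_on_def vector_derivative_works
      has_real_derivative_iff_has_vector_derivative)

lemma C1_01_tendsto:
  assumes "C1_01 g" "u \<in> {0..1}" and U: "filterlim U (at u within {0..1}) F"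
  shows "((\<lambda>y. g (U y)) \<longlongrightarrow> g u) F"
proof -
  have "(g \<longlongrightarrow> g u) (at u within {0..1})"
    using DERIV_continuous[OF C1_01_has_derivative[OF assms(1,2)]] by (simp add: continuous_within)
  from filterlim_compose[OF this U] show ?thesis .
qed

lemma C1_01_difference_quotient:
  assumes "C1_01 g" "u \<in> {0..1}" and U: "filterlim U (at u within {0..1}) F"
  shows "((\<lambda>y. (g (U y) - g u) / (U y - u)) \<longlongrightarrow> deriv01 g u) F"
proof -
  have "((\<lambda>v. (g v - g u) / (v - u)) \<longlongrightarrow> deriv01 g u) (at u within {0..1})"
    using C1_01_has_derivative[OF assms(1,2)] by (simp add: has_field_derivative_iff)
  from filterlim_compose[OF this U] show ?thesis .
qed

lemma C1_01_INF_pos: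
  assumes "C1_01 g" "0 < (INF u\<in>{0..1}. g u)" "u \<in> {0..1}"
  shows "g u > 0"
proof -
  have "continuous_on {0..1} g"
    using assms(1) by (simp add: C1_01_def differentiable_imp_continuous_on)
  \<comment> \<open>A real \<open>INF\<close> is known to be a lower bound only for a set bounded
    below, which compactness supplies.\<close>
  then have "bdd_below (g ` {0..1})"
    by (intro bounded_imp_bdd_below compact_imp_bounded compact_continuous_image) auto
  from cINF_lower[OF this assms(3)] show ?thesis using assms(2) by simp
qed

section \<open>Regularity, range and flux of the wave\<close>

lemma travelling_waveD:
  assumes "travelling_wave s b f c V"
  shows "C2_real V" "strict_mono V" "(V \<longlongrightarrow> 0) at_bot" "(V \<longlongrightarrow> 1) at_top"
    "deriv (\<lambda>\<eta>. s (V \<eta>) / 2 * deriv V \<eta>) y = - ((c - b (V y)) * deriv V y + f (V y))"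
proof -
  note unfolded = assms[unfolded travelling_wave_def]
  show "C2_real V" "strict_mono V" "(V \<longlongrightarrow> 0) at_bot" "(V \<longlongrightarrow> 1) at_top"
    using unfolded by blast+
  have "deriv (\<lambda>\<eta>. s (V \<eta>) / 2 * deriv V \<eta>) y + (c - b (V y)) * deriv V y + f (V y) = 0"
    using unfolded by blast
  then show "deriv (\<lambda>\<eta>. s (V \<eta>) / 2 * deriv V \<eta>) y = - ((c - b (V y)) * deriv V y + f (V y))"
    by linarith
qed

lemma travelling_wave_derivatives:
  assumes "travelling_wave s b f c V"
  shows "(V has_real_derivative deriv V y) (at y)"
    and "(deriv V has_real_derivative deriv (deriv V) y) (at y)"
    and "deriv V y \<ge> 0"
proof -
  show V': "(V has_real_derivative deriv V y) (at y)"
    and "(deriv V has_real_derivative deriv (deriv V) y) (at y)"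
    using travelling_waveD(1)[OF assms]
    by (auto simp: C2_real_def differentiable_on_def DERIV_deriv_iff_real_differentiable)
  show "deriv V y \<ge> 0"
  proof (rule ccontr)
    assume "\<not> deriv V y \<ge> 0"
    then obtain d where d: "d > 0" "\<And>h. 0 < h \<Longrightarrow> h < d \<Longrightarrow> V (y + h) < V y"
      using DERIV_neg_dec_right[OF V'] by auto
    then have "V (y + d / 2) < V y" by simp
    moreover have "V y < V (y + d / 2)"
      by (rule strict_monoD[OF travelling_waveD(2)[OF assms]]) (use d(1) in simp)
    ultimately show False by simp
  qed
qed

lemma travelling_wave_range:
  assumes "travelling_wave s b f c V"
  shows "0 < V y" "V y < 1"
proof -
  have mono: "x < y \<Longrightarrow> V x < V y" for x y
    using travelling_waveD(2)[OF assms] by (rule strict_monoD)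
  \<comment> \<open>Limits give only weak inequalities; a unit step and strict monotonicity make
    them strict at \<open>y\<close>.\<close>
  have "0 \<le> V (y - 1)"
  proof (rule tendsto_upperbound)
    show "(V \<longlongrightarrow> 0) at_bot" by (rule travelling_waveD[OF assms])
    show "\<forall>\<^sub>F x in at_bot. V x \<le> V (y - 1)"
      using eventually_le_at_bot[of "y - 1"] by eventually_elim (metis mono order_le_less)
  qed simp
  then show "0 < V y" using mono[of "y - 1" y] by simp
  have "V (y + 1) \<le> 1"
  proof (rule tendsto_lowerbound)
    show "(V \<longlongrightarrow> 1) at_top" by (rule travelling_waveD[OF assms])
    show "\<forall>\<^sub>F x in at_top. V (y + 1) \<le> V x"
      using eventually_ge_at_top[of "y + 1"] by eventually_elim (metis mono order_le_less)
  qed simp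
  then show "V y < 1" using mono[of y "y + 1"] by simp
qed

text \<open>The wave stays inside the interval and never attains an end value, so it converges in
  the punctured one-sided filter, along which difference quotients converge to
  \<open>deriv01\<close>.\<close>

lemma travelling_wave_filterlim:
  assumes "travelling_wave s b f c V"
  shows "filterlim V (at 1 within {0..1}) at_top" "filterlim V (at 0 within {0..1}) at_bot"
proof -
  have "V y \<noteq> 0" "V y \<noteq> 1" "V y \<in> {0..1}" for y
    using travelling_wave_range[OF assms, of y] by auto
  then show "filterlim V (at 1 within {0..1}) at_top" "filterlim V (at 0 within {0..1}) at_bot"
    using travelling_waveD(3,4)[OF assms] by (auto simp: filterlim_at)
qed

text \<open>The wave equation prescribes only the value of \<open>deriv\<close>. Since
  \<open>V y\<close> is interior, \<open>deriv01\<close> of \<open>s\<close> is there a two-sided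
  derivative, so the chain and product rules make the flux differentiable with that value.\<close>

lemma travelling_wave_flux:
  assumes V: "travelling_wave s b f c V" and "C1_01 s"
  shows "((\<lambda>y. s (V y) / 2 * deriv V y) has_real_derivative
    - ((c - b (V y)) * deriv V y + f (V y))) (at y)"
proof -
  note range = travelling_wave_range[OF V]
  have "at (V y) within {0..1} = at (V y)"
    using range by (intro at_within_interior) simp
  then have "(s has_real_derivative deriv01 s (V y)) (at (V y))"
    using C1_01_has_derivative[OF \<open>C1_01 s\<close>, of "V y"] range[of y] by simp
  from DERIV_chain2[OF this travelling_wave_derivatives(1)[OF V]]
  have "((\<lambda>y. s (V y) / 2) has_real_derivative deriv01 s (V y) * deriv V y / 2) (at y)"
    by (rule DERIV_cdivide)
  from DERIV_mult[OF this travelling_wave_derivatives(2)[OF V]]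
  have "\<exists>D. ((\<lambda>y. s (V y) / 2 * deriv V y) has_real_derivative D) (at y)" ..
  then obtain D where D: "((\<lambda>y. s (V y) / 2 * deriv V y) has_real_derivative D) (at y)" by blast
  show ?thesis using D unfolding travelling_waveD(5)[OF V, symmetric] DERIV_imp_deriv[OF D] .
qed

section \<open>Decay of the wave at the two ends\<close>

text \<open>Writing \<open>f (V y)\<close> as its difference quotient at 1 times
  \<open>V y - 1\<close> turns the nonlinear equation into a linear one for \<open>1 - V\<close>,
  whose coefficient \<open>g\<close> tends to \<open>deriv01 f 1\<close>.\<close>

lemma travelling_wave_decay_at_top:
  assumes V: "travelling_wave s b f c V" and C1: "C1_01 s" "C1_01 b" "C1_01 f"
    and s: "\<And>u. u \<in> {0..1} \<Longrightarrow> s u > 0" and "f 1 = 0" "deriv01 f 1 < 0"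
    and r: "r > 0" "s 1 / 2 * r\<^sup>2 - (c - b 1) * r + deriv01 f 1 = 0"
  shows "((\<lambda>y. ln (1 - V y) / y) \<longlongrightarrow> - r) at_top"
proof (rule log_decay_rate[where W' = "\<lambda>y. - deriv V y" and p = "\<lambda>y. s (V y) / 2"
      and k = "\<lambda>y. c - b (V y)" and g = "\<lambda>y. (f (V y) - f 1) / (V y - 1)", OF _ _ _ _ _ _ _ _ _ _ r])
  note range = travelling_wave_range[OF V]
  note lim = travelling_wave_filterlim(1)[OF V]
  show "((\<lambda>y. 1 - V y) has_real_derivative - deriv V y) (at y)" for y
    by (auto intro!: derivative_eq_intros travelling_wave_derivatives[OF V])
  show "((\<lambda>y. s (V y) / 2 * - deriv V y) has_real_derivative
      - ((c - b (V y)) * - deriv V y + (f (V y) - f 1) / (V y - 1) * (1 - V y))) (at y)" for y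
  proof -
    have "(f (V y) - f 1) / (V y - 1) * (1 - V y) = - f (V y)"
      using range(2)[of y] \<open>f 1 = 0\<close> by (simp add: field_simps)
    then show ?thesis
      using DERIV_minus[OF travelling_wave_flux[OF V C1(1), of y]] by simp
  qed
  show "1 - V y > 0" "s (V y) / 2 > 0" "- deriv V y \<le> 0" for y
    using range[of y] s[of "V y"] travelling_wave_derivatives(3)[OF V] by auto
  show "((\<lambda>y. s (V y) / 2) \<longlongrightarrow> s 1 / 2) at_top" "((\<lambda>y. c - b (V y)) \<longlongrightarrow> c - b 1) at_top"
    "((\<lambda>y. (f (V y) - f 1) / (V y - 1)) \<longlongrightarrow> deriv01 f 1) at_top"
    by (intro tendsto_intros C1_01_tendsto C1_01_difference_quotient C1 lim; simp)+
  show "s 1 / 2 > 0" "deriv01 f 1 < 0" using s[of 1] \<open>deriv01 f 1 < 0\<close> by auto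
qed

text \<open>Reflecting \<open>y\<close> reduces this end to \<open>at_top\<close>. The reflection
  reverses the sign of the drift \<open>k\<close>, whence the plus sign before
  \<open>c - b 0\<close> in the quadratic.\<close>

lemma travelling_wave_decay_at_bot:
  assumes V: "travelling_wave s b f c V" and C1: "C1_01 s" "C1_01 b" "C1_01 f"
    and s: "\<And>u. u \<in> {0..1} \<Longrightarrow> s u > 0" and "f 0 = 0" "deriv01 f 0 < 0"
    and r: "r > 0" "s 0 / 2 * r\<^sup>2 + (c - b 0) * r + deriv01 f 0 = 0"
  shows "((\<lambda>y. ln (V y) / y) \<longlongrightarrow> r) at_bot"
proof -
  note range = travelling_wave_range[OF V]
  have lim: "filterlim (\<lambda>y. V (- y)) (at 0 within {0..1}) at_top"
    using travelling_wave_filterlim(2)[OF V] unfolding filterlim_at_bot_mirror .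
  have neg: "(uminus has_real_derivative - 1) (at y)" for y :: real
    by (auto intro!: derivative_eq_intros)
  have "((\<lambda>y. ln (V (- y)) / y) \<longlongrightarrow> - r) at_top"
  proof (rule log_decay_rate[where W' = "\<lambda>y. - deriv V (- y)" and p = "\<lambda>y. s (V (- y)) / 2"
        and k = "\<lambda>y. - (c - b (V (- y)))" and g = "\<lambda>y. (f (V (- y)) - f 0) / (V (- y) - 0)"
        and ?k0.0 = "- (c - b 0)"])
    show "((\<lambda>y. V (- y)) has_real_derivative - deriv V (- y)) (at y)" for y
      using DERIV_chain2[OF travelling_wave_derivatives(1)[OF V] neg] by simp
    show "((\<lambda>y. s (V (- y)) / 2 * - deriv V (- y)) has_real_derivative
        - (- (c - b (V (- y))) * - deriv V (- y) + (f (V (- y)) - f 0) / (V (- y) - 0) * V (- y)))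
        (at y)" for y
    proof -
      have "(f (V (- y)) - f 0) / (V (- y) - 0) * V (- y) = f (V (- y))"
        using range(1)[of "- y"] \<open>f 0 = 0\<close> by simp
      then show ?thesis
        using DERIV_minus[OF DERIV_chain2[OF travelling_wave_flux[OF V C1(1)] neg], of y]
        by (simp add: algebra_simps)
    qed
    show "V (- y) > 0" "s (V (- y)) / 2 > 0" "- deriv V (- y) \<le> 0" for y
      using range[of "- y"] s[of "V (- y)"] travelling_wave_derivatives(3)[OF V] by auto
    show "((\<lambda>y. s (V (- y)) / 2) \<longlongrightarrow> s 0 / 2) at_top"
      "((\<lambda>y. - (c - b (V (- y)))) \<longlongrightarrow> - (c - b 0)) at_top"
      "((\<lambda>y. (f (V (- y)) - f 0) / (V (- y) - 0)) \<longlongrightarrow> deriv01 f 0) at_top"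
      by (intro tendsto_intros C1_01_tendsto C1_01_difference_quotient C1 lim; simp)+
    show "s 0 / 2 > 0" "deriv01 f 0 < 0" using s[of 0] \<open>deriv01 f 0 < 0\<close> by auto
    show "r > 0" "s 0 / 2 * r\<^sup>2 - - (c - b 0) * r + deriv01 f 0 = 0"
      using r by (auto simp: algebra_simps)
  qed
  from tendsto_minus[OF this] show ?thesis unfolding filterlim_at_bot_mirror by simp
qed

section \<open>Pareto tail and conclusion\<close>

text \<open>With \<open>y = ln x\<close> and \<open>x > 0\<close> the exponential becomes a power of
  \<open>x\<close>; the error stays small since \<open>ln\<close> tends to infinity.\<close>

lemma pareto_tail_ln:
  assumes "\<alpha> > 0" and "\<epsilon> \<in> o[at_top](\<lambda>_. 1)"
    and tail: "\<forall>\<^sub>F y in at_top. 1 - F y = exp (- \<alpha> * y * (1 + \<epsilon> y))"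
  shows "pareto_tail (\<lambda>x. F (ln x)) \<alpha>"
  unfolding pareto_tail_def
proof (intro conjI bexI)
  show "(\<lambda>x. \<epsilon> (ln x)) \<in> o[at_top](\<lambda>_. 1)"
    using landau_o.small.compose[OF assms(2) ln_at_top] by simp
  have "\<forall>\<^sub>F x in at_top. 1 - F (ln x) = exp (- \<alpha> * ln x * (1 + \<epsilon> (ln x)))"
    using eventually_compose_filterlim[OF tail ln_at_top] .
  then show "\<forall>\<^sub>F x in at_top. 1 - F (ln x) = x powr (- \<alpha> * (1 + \<epsilon> (ln x)))"
    using eventually_gt_at_top[of 0] by eventually_elim (simp add: powr_def mult_ac)
qed fact

theorem corollary4p4:
  fixes \<sigma>2 b f V :: "real \<Rightarrow> real" and q c a \<alpha> :: real
  assumes "C1_01 \<sigma>2" and "C1_01 b" and "C1_01 f"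
    and "0 < (INF u\<in>{0..1}. \<sigma>2 u)"
    and "f 0 = 0" and "f 1 = 0"
    and "q \<in> {0<..<1}" and "{u \<in> {0<..<1}. f u = 0} = {q}"
    and "\<forall>u\<in>{0<..<q}. f u < 0" and "\<forall>u\<in>{q<..<1}. f u > 0"
    and "deriv01 f 0 < 0" and "deriv01 f q > 0" and "deriv01 f 1 < 0"
    and "travelling_wave \<sigma>2 b f c V"
    and "a = c - b 1"
    and "\<alpha> = (a + sqrt (a\<^sup>2 - 2 * \<sigma>2 1 * deriv01 f 1)) / \<sigma>2 1"
  shows "(\<exists>\<epsilon> \<in> o[at_top](\<lambda>_. 1). \<forall>\<^sub>F y in at_top. 1 - V y = exp (- \<alpha> * y * (1 + \<epsilon> y)))
    \<and> pareto_tail (\<lambda>x. V (ln x)) \<alpha>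
    \<and> (\<exists>\<beta>. {r. r > 0 \<and> 1/2 * \<sigma>2 0 * r\<^sup>2 + (c - b 0) * r + deriv01 f 0 = 0} = {\<beta>}
          \<and> (\<exists>\<epsilon> \<in> o[at_bot](\<lambda>_. 1). \<forall>\<^sub>F y in at_bot. V y = exp (\<beta> * y * (1 + \<epsilon> y))))"
proof -
  note V = \<open>travelling_wave \<sigma>2 b f c V\<close>
  note range = travelling_wave_range[OF V]
  have s: "\<sigma>2 u > 0" if "u \<in> {0..1}" for u
    using C1_01_INF_pos[OF assms(1,4) that] .
  \<comment> \<open>With leading coefficient \<open>\<sigma>2 1 / 2\<close> and linear coefficient
    \<open>- a\<close>, the root formula is exactly the given expression for
    \<open>\<alpha>\<close>.\<close>
  have "{r. r > 0 \<and> \<sigma>2 1 / 2 * r\<^sup>2 + (- a) * r + deriv01 f 1 = 0} = {\<alpha>}"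
    using quadratic_positive_root[of "\<sigma>2 1 / 2" "deriv01 f 1" "- a"] s[of 1]
      \<open>deriv01 f 1 < 0\<close> assms(16) by simp
  then have "\<alpha> > 0 \<and> \<sigma>2 1 / 2 * \<alpha>\<^sup>2 + (- a) * \<alpha> + deriv01 f 1 = 0" by blast
  then have \<alpha>: "\<alpha> > 0" "\<sigma>2 1 / 2 * \<alpha>\<^sup>2 - (c - b 1) * \<alpha> + deriv01 f 1 = 0"
    unfolding \<open>a = c - b 1\<close> by (auto simp: algebra_simps)
  have "((\<lambda>y. ln (1 - V y) / y) \<longlongrightarrow> - \<alpha>) at_top"
    using travelling_wave_decay_at_top[OF V assms(1-3) s assms(6,13) \<alpha>] by blast
  then have top: "\<exists>\<epsilon> \<in> o[at_top](\<lambda>_. 1). \<forall>\<^sub>F y in at_top. 1 - V y = exp (- \<alpha> * y * (1 + \<epsilon> y))"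
    using \<alpha>(1) range eventually_gt_at_top[of "0::real"]
    by (intro exp_asymptotics) (auto elim: eventually_mono)
  then have tail: "pareto_tail (\<lambda>x. V (ln x)) \<alpha>"
    using pareto_tail_ln[OF \<alpha>(1)] by blast
  obtain \<beta> where root: "{r. r > 0 \<and> 1/2 * \<sigma>2 0 * r\<^sup>2 + (c - b 0) * r + deriv01 f 0 = 0} = {\<beta>}"
    using quadratic_positive_root[of "1/2 * \<sigma>2 0" "deriv01 f 0" "c - b 0"] s[of 0]
      \<open>deriv01 f 0 < 0\<close> by simp
  then have "\<beta> > 0 \<and> 1/2 * \<sigma>2 0 * \<beta>\<^sup>2 + (c - b 0) * \<beta> + deriv01 f 0 = 0" by blast
  then have "\<beta> > 0" "\<sigma>2 0 / 2 * \<beta>\<^sup>2 + (c - b 0) * \<beta> + deriv01 f 0 = 0" by auto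
  from travelling_wave_decay_at_bot[OF V assms(1-3) s assms(5,11) this]
  have "((\<lambda>y. ln (V y) / y) \<longlongrightarrow> \<beta>) at_bot" by blast
  then have "\<exists>\<epsilon> \<in> o[at_bot](\<lambda>_. 1). \<forall>\<^sub>F y in at_bot. V y = exp (\<beta> * y * (1 + \<epsilon> y))"
    using \<open>\<beta> > 0\<close> range eventually_gt_at_bot[of "0::real"]
    by (intro exp_asymptotics) (auto elim: eventually_mono)
  with root top tail show ?thesis by blast
qed

end
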